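(* Let $k$ be a positive integer and let $G$ be a $k$-connected irregular graph of order $n$ and size $m$. If the maximum degree of $G$ is $\Delta$, then $$\Delta-\lambda_{1}(G)>\frac{(n\Delta-2m)k^{2}}{(n\Delta-2m)\left((n-1)^{2}-(n-k-1)(\Delta-k+1)\right)+nk^{2}}.$$
   Context: All graphs are finite and simple. The order of $G$ is its number of vertices and the size is its number of edges. $\lambda_1(G)$ denotes the spectral radius of $G$, i.e. the largest eigenvalue of its adjacency matrix. A graph is irregular if its vertices do not all have the same degree. A graph is $k$-connected in the usual (vertex-connectivity) sense: it has more than $k$ vertices and remains connected after removal of any fewer than $k$ vertices. *)

theory Defs
  imports "Graph_Theory.Graph_Theory" "Jordan_Normal_Form.Spectral_Radius"
begin

text \<open>
  Finite simple graphs are the finite, loop-free, symmetric digraphs without multiple arcs of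
  \<^locale>\<open>graph\<close>. An undirected edge is a pair of opposite arcs there, so the degree of a vertex is
  its \<^const>\<open>out_degree\<close>, but the size of the graph is half the number of arcs; it is
  defined as the number of unordered end pairs.
\<close>

definition graph_order :: "('a, 'b) pre_digraph \<Rightarrow> nat" where
  "graph_order G = card (verts G)"

definition graph_size :: "('a, 'b) pre_digraph \<Rightarrow> nat" where
  "graph_size G = card ((\<lambda>e. {tail G e, head G e}) ` arcs G)"

definition max_degree :: "('a, 'b) pre_digraph \<Rightarrow> nat" where
  "max_degree G = Max (out_degree G ` verts G)"

definition irregular :: "('a, 'b) pre_digraph \<Rightarrow> bool" where
  "irregular G \<longleftrightarrow> (\<exists>u\<in>verts G. \<exists>v\<in>verts G. out_degree G u \<noteq> out_degree G v)"

definition k_connected :: "nat \<Rightarrow> ('a, 'b) pre_digraph \<Rightarrow> bool" where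
  "k_connected k G \<longleftrightarrow> k < card (verts G) \<and>
     (\<forall>S. S \<subseteq> verts G \<and> card S < k \<longrightarrow> Digraph_Component.connected (G \<restriction> (verts G - S)))"

definition adjacency_matrix :: "('a, 'b) pre_digraph \<Rightarrow> 'a list \<Rightarrow> real mat" where
  "adjacency_matrix G vs =
     mat (length vs) (length vs) (\<lambda>(i, j). if vs ! i \<rightarrow>\<^bsub>G\<^esub> vs ! j then 1 else 0)"

text \<open>
  The matrix depends on the listing \<open>vs\<close> of the vertices, its spectrum does not
  (see \<open>lambda1_eq\<close> below), so the choice made here is immaterial. As the matrix is real symmetric,
  all its eigenvalues are real and the largest one is the maximum of its real spectrum.
\<close>

definition lambda1 :: "('a, 'b) pre_digraph \<Rightarrow> real" where
  "lambda1 G = Max (spectrum (adjacency_matrix G (SOME vs. distinct vs \<and> set vs = verts G)))"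

lemma adjacency_matrix_mult_vec:
  assumes "x \<in> carrier_vec (length vs)" "i < length vs"
  shows "(adjacency_matrix G vs *\<^sub>v x) $ i
    = (\<Sum>j<length vs. (if vs ! i \<rightarrow>\<^bsub>G\<^esub> vs ! j then 1 else 0) * x $ j)"
proof -
  have "(adjacency_matrix G vs *\<^sub>v x) $ i
      = (\<Sum>j = 0..<length vs. row (adjacency_matrix G vs) i $ j * x $ j)"
    using assms by (simp add: scalar_prod_def adjacency_matrix_def)
  also have "\<dots> = (\<Sum>j<length vs. (if vs ! i \<rightarrow>\<^bsub>G\<^esub> vs ! j then 1 else 0) * x $ j)"
    by (rule sum.cong) (use assms in \<open>auto simp: adjacency_matrix_def\<close>)
  finally show ?thesis .
qed

lemma spectrum_adjacency_matrix_subset: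
  assumes vs: "distinct vs" and ws: "distinct ws" and eq: "set vs = set ws"
  shows "spectrum (adjacency_matrix G vs) \<subseteq> spectrum (adjacency_matrix G ws)"
proof
  fix c assume "c \<in> spectrum (adjacency_matrix G vs)"
  then obtain x where x: "x \<in> carrier_vec (length vs)" "x \<noteq> 0\<^sub>v (length vs)"
    and ev: "adjacency_matrix G vs *\<^sub>v x = c \<cdot>\<^sub>v x"
    by (auto simp: spectrum_def eigenvalue_def eigenvector_def adjacency_matrix_def)
  let ?n = "length vs"
  have len: "length ws = ?n" using vs ws eq by (metis distinct_card)
  have bv: "bij_betw ((!) vs) {..<?n} (set vs)" using vs by (simp add: bij_betw_nth)
  have bw: "bij_betw ((!) ws) {..<?n} (set vs)" using ws eq len by (simp add: bij_betw_nth)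
  define p where "p = the_inv_into {..<?n} ((!) vs) \<circ> (!) ws"
  have p: "bij_betw p {..<?n} {..<?n}"
    unfolding p_def by (rule bij_betw_trans[OF bw bij_betw_the_inv_into[OF bv]])
  have pl: "p i < ?n" if "i < ?n" for i
    using p that by (auto simp: bij_betw_def)
  have pv: "vs ! p i = ws ! i" if "i < ?n" for i
    using f_the_inv_into_f_bij_betw[OF bv, of "ws ! i"] bw that
    by (auto simp: p_def bij_betw_def)
  define y where "y = vec ?n (\<lambda>i. x $ p i)"
  have row: "(\<Sum>j<?n. (if vs ! i \<rightarrow>\<^bsub>G\<^esub> vs ! j then 1 else 0) * x $ j) = c * x $ i" if "i < ?n" for i
  proof -
    have "(adjacency_matrix G vs *\<^sub>v x) $ i = (c \<cdot>\<^sub>v x) $ i" using ev by simp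
    then show ?thesis using that x by (simp add: adjacency_matrix_mult_vec)
  qed
  have "adjacency_matrix G ws *\<^sub>v y = c \<cdot>\<^sub>v y"
  proof (rule eq_vecI)
    fix i assume "i < dim_vec (c \<cdot>\<^sub>v y)"
    then have i: "i < ?n" by (simp add: y_def)
    have "(adjacency_matrix G ws *\<^sub>v y) $ i
        = (\<Sum>j<?n. (if ws ! i \<rightarrow>\<^bsub>G\<^esub> ws ! j then 1 else 0) * x $ p j)"
      using i len pl by (simp add: adjacency_matrix_mult_vec y_def)
    also have "\<dots> = (\<Sum>j<?n. (if vs ! p i \<rightarrow>\<^bsub>G\<^esub> vs ! p j then 1 else 0) * x $ p j)"
      by (rule sum.cong) (use pv i in auto)
    also have "\<dots> = (\<Sum>j<?n. (if vs ! p i \<rightarrow>\<^bsub>G\<^esub> vs ! j then 1 else 0) * x $ j)"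
      by (rule sum.reindex_bij_betw[OF p])
    also have "\<dots> = c * x $ p i" using row pl i by blast
    finally show "(adjacency_matrix G ws *\<^sub>v y) $ i = (c \<cdot>\<^sub>v y) $ i"
      using i by (simp add: y_def)
  qed (simp add: y_def adjacency_matrix_def len)
  moreover have "y \<noteq> 0\<^sub>v ?n"
  proof
    assume y0: "y = 0\<^sub>v ?n"
    have "x $ j = 0" if j: "j < ?n" for j
    proof -
      obtain i where i: "i < ?n" "j = p i" using p j by (auto simp: bij_betw_def image_iff set_eq_iff)
      have "y $ i = 0" using y0 i by simp
      then show ?thesis using i by (simp add: y_def)
    qed
    then show False using x by (auto intro!: eq_vecI)
  qed
  ultimately show "c \<in> spectrum (adjacency_matrix G ws)"
    by (auto simp: spectrum_def eigenvalue_def eigenvector_def adjacency_matrix_def len y_def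
        intro!: exI[of _ y])
qed

lemma lambda1_eq:
  assumes "distinct vs" "set vs = verts G"
  shows "lambda1 G = Max (spectrum (adjacency_matrix G vs))"
proof -
  define ws where "ws = (SOME vs. distinct vs \<and> set vs = verts G)"
  have "distinct ws \<and> set ws = verts G"
    unfolding ws_def by (rule someI[of _ vs]) (use assms in simp)
  then have "spectrum (adjacency_matrix G ws) = spectrum (adjacency_matrix G vs)"
    using assms by (intro equalityI spectrum_adjacency_matrix_subset) auto
  then show ?thesis by (simp add: lambda1_def ws_def)
qed

end

theory Submission
  imports Defs
begin

text \<open>
  Let \<open>\<gamma> = \<Delta> - \<lambda>\<^sub>1\<close> and let \<open>y\<^sub>0 \<ge> \<dots> \<ge> y\<^sub>N\<close> be the sorted absolute values of an eigenvector for \<open>\<lambda>\<^sub>1\<close>,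
  so that \<open>(\<Delta> I - A) y \<le> \<gamma> y\<close> entrywise. Summing this over the \<open>j + 1\<close> largest entries bounds the
  flux through the cut after position \<open>j\<close> by \<open>\<gamma> y\<^sub>0 (j + 1)\<close>. By summation by parts this flux is a
  combination of the steps \<open>y\<^sub>i - y\<^sub>i\<^sub>+\<^sub>1\<close>, in which the step \<open>i\<close> has as coefficient at least the number
  of edges between the first \<open>min i j + 1\<close> and the last \<open>N - max i j\<close> vertices. As deleting the
  \<open>\<bar>i - j\<bar>\<close> vertices in between leaves a \<open>(k - \<bar>i - j\<bar>)\<close>-connected graph, this number is at least
  \<open>k - \<bar>i - j\<bar>\<close>; for \<open>j = 0\<close> the coefficient is also at least \<open>\<Delta> - i\<close>. A suitable combination of
  the cuts \<open>j = 0\<close> and \<open>j \<ge> \<Delta>\<close> bounds \<open>k\<^sup>2 (y\<^sub>0 - y\<^sub>N)\<close>, and the total flux out of the graph gives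
  \<open>(n \<Delta> - 2 m) y\<^sub>N \<le> \<gamma> n y\<^sub>0\<close>.
\<close>

section \<open>Sums of the tent-shaped lower bounds over consecutive cuts\<close>

text \<open>The full triangular sum lacks exactly \<open>(k - s - 1) * (k - s)\<close> after
  doubling. Enlarging the first factor to \<open>k - 1\<close> makes the remainder a fixed multiple
  of \<open>k - s\<close>, the tent value at the last cut.\<close>

lemma sum_decreasing_nat_ge:
  fixes k s :: nat
  assumes "k > 0"
  shows "k * (k + 1) \<le> 2 * (\<Sum>d\<le>s. k - d) + (k - 1) * (k - s)"
proof -
  have "k * (k + 1) = 2 * (\<Sum>d\<le>s. k - d) + (k - s - 1) * (k - s)"
  proof (induction s)
    case 0
    then show ?case using assms by (cases k) (auto simp: algebra_simps)
  next
    case (Suc s)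
    show ?case
    proof (cases "s < k")
      case True
      then obtain t where t: "k = s + Suc t" by (auto simp: less_iff_Suc_add)
      with Suc show ?thesis by (cases t) (auto simp: algebra_simps)
    qed (use Suc in simp)
  qed
  also have "(k - s - 1) * (k - s) \<le> (k - 1) * (k - s)" by (rule mult_right_mono) auto
  finally show ?thesis by simp
qed

definition tent :: "nat \<Rightarrow> nat \<Rightarrow> nat \<Rightarrow> nat" where
  "tent k i j = k - (if i \<le> j then j - i else i - j)"

lemma sum_tent_right: "i \<le> q \<Longrightarrow> (\<Sum>j=i..q. tent k i j) = (\<Sum>d\<le>q - i. k - d)"
  by (rule sum.reindex_bij_witness[of _ "\<lambda>d. i + d" "\<lambda>j. j - i"]) (auto simp: tent_def)

lemma sum_tent_left: "p \<le> i \<Longrightarrow> (\<Sum>j=p..i. tent k i j) = (\<Sum>d\<le>i - p. k - d)"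
  by (rule sum.reindex_bij_witness[of _ "\<lambda>d. i - d" "\<lambda>j. i - j"]) (auto simp: tent_def)

text \<open>The two half tents overlap only in \<open>i\<close>, with value \<open>k\<close>, and
  \<open>2 * k * (k + 1) - 2 * k = 2 * k^2\<close>.\<close>

lemma tent_cover_inside:
  assumes "k > 0" "p \<le> i" "i \<le> q"
  shows "2 * k^2 \<le> 2 * (\<Sum>j=p..q. tent k i j) + (k - 1) * (tent k i p + tent k i q)"
proof -
  have "{p..q} = {p..i} \<union> {i..q}" "{p..i} \<inter> {i..q} = {i}" using assms by auto
  then have "(\<Sum>j=p..q. tent k i j) + k = (\<Sum>j=p..i. tent k i j) + (\<Sum>j=i..q. tent k i j)"
    using sum.union_inter[of "{p..i}" "{i..q}" "tent k i"] by (simp add: tent_def)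
  moreover have "tent k i p = k - (i - p)" "tent k i q = k - (q - i)"
    using assms by (auto simp: tent_def)
  moreover note sum_tent_left[OF assms(2), of k] sum_tent_right[OF assms(3), of k]
    sum_decreasing_nat_ge[OF assms(1), of "i - p"] sum_decreasing_nat_ge[OF assms(1), of "q - i"]
  ultimately show ?thesis by (simp add: power2_eq_square algebra_simps)
qed

text \<open>The half tent to the right of \<open>i\<close> gives \<open>k * (k + 1)\<close>, and the
  extra weight at \<open>p\<close> the other \<open>(k - 1) * k\<close>. Each of the
  \<open>p - i\<close> positions before \<open>p\<close> costs up to \<open>2 * k\<close> in the
  former and \<open>k - 1\<close> in the latter, hence \<open>3 * k - 1\<close>.\<close>

lemma tent_cover_left:
  assumes "k > 0" "i < p" "p \<le> q"
  shows "2 * k^2 \<le> 2 * (\<Sum>j=p..q. tent k i j) + (k - 1) * (tent k i p + tent k i q)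
    + (3 * k - 1) * (p - i)"
proof -
  have "{i..q} = {i..<p} \<union> {p..q}" "{i..<p} \<inter> {p..q} = {}" using assms by auto
  then have "(\<Sum>j=i..q. tent k i j) = (\<Sum>j=i..<p. tent k i j) + (\<Sum>j=p..q. tent k i j)"
    by (simp add: sum.union_disjoint)
  moreover have "(\<Sum>j=i..<p. tent k i j) \<le> (p - i) * k"
  proof -
    have "(\<Sum>j=i..<p. tent k i j) \<le> (\<Sum>j=i..<p. k)" by (rule sum_mono) (simp only: tent_def diff_le_self)
    then show ?thesis by simp
  qed
  moreover have "tent k i q = k - (q - i)" using assms by (auto simp: tent_def)
  moreover have "(\<Sum>j=i..q. tent k i j) = (\<Sum>d\<le>q - i. k - d)"
    using assms by (intro sum_tent_right) simp
  moreover note sum_decreasing_nat_ge[OF assms(1), of "q - i"]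
  ultimately have 1: "k * (k + 1) \<le> 2 * (\<Sum>j=p..q. tent k i j) + 2 * ((p - i) * k) + (k - 1) * tent k i q"
    by simp
  have "(k - 1) * k \<le> (k - 1) * (tent k i p + (p - i))"
    using assms by (intro mult_left_mono) (auto simp: tent_def)
  with 1 have "k * (k + 1) + (k - 1) * k \<le> 2 * (\<Sum>j=p..q. tent k i j) + 2 * ((p - i) * k)
     + (k - 1) * tent k i q + (k - 1) * (tent k i p + (p - i))"
    by linarith
  moreover have "k * (k + 1) + (k - 1) * k = 2 * k^2"
    using assms by (cases k) (auto simp: power2_eq_square)
  moreover have "2 * (s * k) + (k - 1) * s = (3 * k - 1) * s" for s
    using assms by (cases k) (auto simp: algebra_simps)
  note this[of "p - i"]
  ultimately show ?thesis by (simp add: algebra_simps)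
qed

section \<open>Summation by parts and the flux through the cuts of a weighted graph\<close>

lemma sum_mult_combination:
  fixes g :: "'i \<Rightarrow> real"
  shows "(\<Sum>i\<in>I. g i * (c * (\<Sum>j\<in>J. f j i) + a * (u i + v i) + b * z i)) =
    c * (\<Sum>j\<in>J. \<Sum>i\<in>I. g i * f j i) + a * ((\<Sum>i\<in>I. g i * u i) + (\<Sum>i\<in>I. g i * v i))
      + b * (\<Sum>i\<in>I. g i * z i)"
proof -
  have "(\<Sum>j\<in>J. \<Sum>i\<in>I. g i * f j i) = (\<Sum>i\<in>I. g i * (\<Sum>j\<in>J. f j i))"
    by (subst sum.swap) (simp add: sum_distrib_left)
  then show ?thesis
    by (simp add: distrib_left sum.distrib sum_distrib_left mult.left_commute)
qed

lemma sum_by_parts: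
  fixes f y :: "nat \<Rightarrow> real"
  shows "(\<Sum>b\<le>N. f b * y b) = (\<Sum>b\<le>N. f b) * y N + (\<Sum>i<N. (y i - y (Suc i)) * (\<Sum>b\<le>i. f b))"
  by (induction N) (auto simp: algebra_simps)

text \<open>\<open>w\<close> models the adjacency matrix on the sorted vertices. The eigenvalue
  equation enters as the inequality \<open>super\<close>, because passing to absolute values keeps
  only this direction. In \<open>cut_ge\<close> the term \<open>i - j\<close> counts the vertices on
  neither side of the cut; \<open>deficit_pos\<close> encodes irregularity.\<close>

locale ordered_weights =
  fixes N k \<Delta> :: nat and w :: "nat \<Rightarrow> nat \<Rightarrow> real" and y :: "nat \<Rightarrow> real" and \<gamma> :: real
  assumes w_sym: "w a b = w b a"
    and w_nonneg: "0 \<le> w a b" and w_le_1: "w a b \<le> 1" and w_diag: "w a a = 0"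
    and degree_le: "a \<le> N \<Longrightarrow> (\<Sum>b\<le>N. w a b) \<le> \<Delta>"
    and cut_ge: "\<lbrakk>j \<le> i; i < N\<rbrakk> \<Longrightarrow> k \<le> (\<Sum>a\<le>j. \<Sum>b\<in>{i<..N}. w a b) + (real i - real j)"
    and y_antimono: "\<lbrakk>i \<le> j; j \<le> N\<rbrakk> \<Longrightarrow> y j \<le> y i"
    and y_nonneg: "i \<le> N \<Longrightarrow> 0 \<le> y i"
    and y_pos: "0 < y 0"
    and super: "a \<le> N \<Longrightarrow> \<Delta> * y a - (\<Sum>b\<le>N. w a b * y b) \<le> \<gamma> * y a"
    and k_pos: "0 < k" and k_less: "k < \<Delta>" and \<Delta>_le: "\<Delta> \<le> N"
    and deficit_pos: "0 < (\<Sum>a\<le>N. \<Delta> - (\<Sum>b\<le>N. w a b))"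
begin

definition flux :: "nat \<Rightarrow> real" where
  "flux j = (\<Sum>a\<le>j. \<Delta> * y a - (\<Sum>b\<le>N. w a b * y b))"

text \<open>The sum of the entries of \<open>\<Delta> I - A\<close> in rows up to \<open>j\<close>
  and columns up to \<open>i\<close>. For \<open>j \<le> i \<le> N\<close> it is the weight between
  the first \<open>j + 1\<close> and the last \<open>N - i\<close> vertices plus the degree deficits
  of the former.\<close>

definition cutw :: "nat \<Rightarrow> nat \<Rightarrow> real" where
  "cutw j i = \<Delta> * (min i j + 1) - (\<Sum>a\<le>j. \<Sum>b\<le>i. w a b)"

lemma cutw_sym: "cutw j i = cutw i j"
proof -
  have "(\<Sum>a\<le>j. \<Sum>b\<le>i. w a b) = (\<Sum>b\<le>i. \<Sum>a\<le>j. w b a)"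
    by (subst sum.swap) (simp add: w_sym)
  then show ?thesis by (simp add: cutw_def min.commute)
qed

lemma flux_eq:
  assumes "j \<le> N"
  shows "flux j = cutw j N * y N + (\<Sum>i<N. (y i - y (Suc i)) * cutw j i)"
proof -
  \<comment> \<open>\<open>f b\<close> sums column \<open>b\<close> of \<open>\<Delta> I - A\<close>
    over the rows up to \<open>j\<close>, so its partial sums are the values of
    \<open>cutw j\<close>.\<close>
  define f where "f b = (if b \<le> j then real \<Delta> else 0) - (\<Sum>a\<le>j. w a b)" for b
  have sub: "(\<Sum>b\<le>i. if b \<le> j then real \<Delta> * g b else 0) = (\<Sum>b\<le>min i j. real \<Delta> * g b)" for i g
    by (rule sum.mono_neutral_cong_right) auto
  have part: "(\<Sum>b\<le>i. f b) = cutw j i" for i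
    using sub[of "\<lambda>_. 1" i] by (simp add: f_def sum_subtractf cutw_def sum.swap[of _ "{..j}"] algebra_simps cong: if_cong)
  have "flux j = (\<Sum>a\<le>j. \<Delta> * y a) - (\<Sum>b\<le>N. \<Sum>a\<le>j. w a b * y b)"
    by (simp add: flux_def sum_subtractf sum.swap[of _ "{..j}"])
  also have "\<dots> = (\<Sum>b\<le>N. f b * y b)"
    using sub[of y N] assms
    by (simp add: f_def left_diff_distrib sum_subtractf sum_distrib_right if_distrib[of "\<lambda>c. c * _"] cong: if_cong)
  also have "\<dots> = cutw j N * y N + (\<Sum>i<N. (y i - y (Suc i)) * cutw j i)"
    by (simp add: sum_by_parts part)
  finally show ?thesis .
qed

lemma cutw_nonneg_aux: "\<lbrakk>j \<le> i; i \<le> N\<rbrakk> \<Longrightarrow> 0 \<le> cutw j i"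
proof -
  assume a: "j \<le> i" "i \<le> N"
  have "(\<Sum>a\<le>j. \<Sum>b\<le>i. w a b) \<le> (\<Sum>a\<le>j. real \<Delta>)"
  proof (rule sum_mono)
    fix u assume "u \<in> {..j}"
    then have "(\<Sum>b\<le>N. w u b) \<le> \<Delta>" using a by (intro degree_le) auto
    moreover have "(\<Sum>b\<le>i. w u b) \<le> (\<Sum>b\<le>N. w u b)"
      using a by (intro sum_mono2) (auto simp: w_nonneg)
    ultimately show "(\<Sum>b\<le>i. w u b) \<le> \<Delta>" by simp
  qed
  then show ?thesis using a by (simp add: cutw_def algebra_simps min_absorb2)
qed

lemma cutw_nonneg: "\<lbrakk>j \<le> N; i \<le> N\<rbrakk> \<Longrightarrow> 0 \<le> cutw j i"
  using cutw_nonneg_aux[of j i] cutw_nonneg_aux[of i j] cutw_sym[of i j] by linarith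

lemma cutw_ge_aux: "\<lbrakk>j \<le> i; i < N\<rbrakk> \<Longrightarrow> real k - (real i - real j) \<le> cutw j i"
proof -
  assume a: "j \<le> i" "i < N"
  have "(\<Sum>a\<le>j. \<Sum>b\<le>N. w a b) \<le> (\<Sum>a\<le>j. real \<Delta>)"
    using a by (intro sum_mono degree_le) auto
  moreover have "{..N} = {..i} \<union> {i<..N}" using a by auto
  then have "(\<Sum>b\<le>N. w u b) = (\<Sum>b\<le>i. w u b) + (\<Sum>b\<in>{i<..N}. w u b)" for u
    by (metis finite_atMost finite_greaterThanAtMost ivl_disj_int_one(3) sum.union_disjoint)
  ultimately show ?thesis using a cut_ge[OF a]
    by (simp add: cutw_def algebra_simps sum.distrib min_absorb2)
qed

lemma cutw_ge_tent: "\<lbrakk>j < N; i < N\<rbrakk> \<Longrightarrow> real (tent k i j) \<le> cutw j i"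
  using cutw_ge_aux[of j i] cutw_ge_aux[of i j] cutw_nonneg[of j i] cutw_sym[of i j]
  by (auto simp: tent_def of_nat_diff_if)

text \<open>By \<open>w_diag\<close>, vertex \<open>0\<close> has weight at most \<open>i\<close> to
  the first \<open>i + 1\<close> vertices.\<close>

lemma cutw_0_ge: "real (\<Delta> - i) \<le> cutw 0 i" if "i < N"
proof -
  have "(\<Sum>b\<le>i. w 0 b) = (\<Sum>b\<in>{0<..i}. w 0 b)"
    by (rule sum.mono_neutral_right) (auto simp: w_diag)
  also have "\<dots> \<le> real i" using sum_bounded_above[of "{0<..i}" "w 0" 1] by (simp add: w_le_1)
  finally show ?thesis using cutw_nonneg[of 0 i] that by (auto simp: cutw_def of_nat_diff_if)
qed

lemma y_step: "i < N \<Longrightarrow> 0 \<le> y i - y (Suc i)"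
  using y_antimono[of i "Suc i"] by simp

lemma flux_ge: "j \<le> N \<Longrightarrow> (\<Sum>i<N. (y i - y (Suc i)) * cutw j i) \<le> flux j"
  using flux_eq[of j] cutw_nonneg[of j N] y_nonneg[of N] by simp

lemma flux_nonneg: "j \<le> N \<Longrightarrow> 0 \<le> flux j"
  by (rule order_trans[OF _ flux_ge]) (auto intro!: sum_nonneg mult_nonneg_nonneg cutw_nonneg y_step)

lemma \<gamma>_nonneg: "0 \<le> \<gamma>"
proof -
  have "0 \<le> \<gamma> * y 0" using flux_nonneg[of 0] super[of 0] by (simp add: flux_def)
  then show ?thesis using y_pos by (simp add: zero_le_mult_iff)
qed

lemma flux_le: "j \<le> N \<Longrightarrow> flux j \<le> \<gamma> * y 0 * (real j + 1)"
proof -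
  assume j: "j \<le> N"
  have "flux j \<le> (\<Sum>a\<le>j. \<gamma> * y 0)"
    unfolding flux_def
  proof (rule sum_mono)
    fix a assume "a \<in> {..j}"
    then have "a \<le> N" using j by simp
    then have "\<gamma> * y a \<le> \<gamma> * y 0" using \<gamma>_nonneg y_antimono[of 0 a] by (intro mult_left_mono) auto
    then show "\<Delta> * y a - (\<Sum>b\<le>N. w a b * y b) \<le> \<gamma> * y 0" using super[OF \<open>a \<le> N\<close>] by simp
  qed
  then show ?thesis by (simp add: algebra_simps)
qed

lemma sum_steps: "(\<Sum>i<N. y i - y (Suc i)) = y 0 - y N"
  by (rule sum_lessThan_telescope')

section \<open>The drop from the largest to the smallest entry, and the resulting gap\<close>

text \<open>For \<open>n = N + 1\<close> this is
  \<open>(n - 1)^2 - (n - k - 1) * (\<Delta> - k + 1)\<close>.\<close>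

definition resist :: real where
  "resist = (real N - k) * (real N - \<Delta> + k - 1) + real k * N"

text \<open>
  The cuts \<open>\<Delta>, \<dots>, N - 1\<close> have multiplicity \<open>2\<close>. The extra multiplicity \<open>k - 1\<close> of the outermost two
  makes up for the truncation of the tents at both ends, and the multiplicity \<open>3 k - 1\<close> of the
  cut \<open>0\<close> covers the steps before \<open>\<Delta>\<close>. For \<open>\<Delta> = N\<close> there are no cuts from \<open>\<Delta>\<close> on,
  but then the cut \<open>0\<close> suffices alone.
\<close>

lemma drop_le: "\<exists>r < resist. (y 0 - y N) * k^2 \<le> \<gamma> * y 0 * r"
proof (cases "\<Delta> = N")
  case True
  have "(y 0 - y N) * 1 \<le> (\<Sum>i<N. (y i - y (Suc i)) * cutw 0 i)"
    unfolding sum_steps[symmetric] sum_distrib_right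
  proof (intro sum_mono mult_left_mono)
    fix i assume "i \<in> {..<N}"
    then show "1 \<le> cutw 0 i" using cutw_0_ge[of i] True by simp
  qed (use y_step in auto)
  then have "y 0 - y N \<le> \<gamma> * y 0" using flux_ge[of 0] flux_le[of 0] by simp
  then have "(y 0 - y N) * k^2 \<le> \<gamma> * y 0 * k^2" by (intro mult_right_mono) auto
  moreover have "real k^2 < resist"
  proof -
    have "resist = (real N - k) * (real k - 1) + real k * N"
      using True unfolding resist_def by simp
    then have "resist - real k^2 = (real N - k) * (2 * real k - 1)"
      by (simp only: power2_eq_square) (simp add: algebra_simps)
    moreover have "0 < (real N - k) * (2 * real k - 1)"
      using k_less k_pos True by (intro mult_pos_pos) auto
    ultimately show ?thesis by simp
  qed
  ultimately show ?thesis by (intro exI[of _ "real k^2"]) simp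
next
  case False
  then have \<Delta>: "\<Delta> < N" using \<Delta>_le by simp
  \<comment> \<open>\<open>N - 1\<close> is the last cut with a vertex beyond it.\<close>
  define q where "q = N - 1"
  have q: "\<Delta> \<le> q" "q < N" and qN: "real q + 1 = N" using \<Delta> by (auto simp: q_def of_nat_diff)
  define Z where "Z = 2 * (\<Sum>j=\<Delta>..q. flux j) + (real k - 1) * (flux \<Delta> + flux q)
    + (3 * real k - 1) * flux 0"
  have k1: "real k - 1 \<ge> 0" "3 * real k - 1 \<ge> 0" using k_pos by auto
  have cover: "2 * real k^2 \<le> 2 * (\<Sum>j=\<Delta>..q. cutw j i) + (real k - 1) * (cutw \<Delta> i + cutw q i)
    + (3 * real k - 1) * cutw 0 i" if i: "i < N" for i
  proof -
    have "2 * k^2 \<le> 2 * (\<Sum>j=\<Delta>..q. tent k i j) + (k - 1) * (tent k i \<Delta> + tent k i q)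
        + (3 * k - 1) * (\<Delta> - i)"
    proof (cases "i < \<Delta>")
      case True
      then show ?thesis using tent_cover_left[OF k_pos True q(1)] by simp
    next
      case False
      then show ?thesis using tent_cover_inside[OF k_pos, of \<Delta> i q] i by (simp add: q_def)
    qed
    then have "real (2 * k^2) \<le> real (2 * (\<Sum>j=\<Delta>..q. tent k i j) + (k - 1) * (tent k i \<Delta> + tent k i q)
        + (3 * k - 1) * (\<Delta> - i))" by (rule of_nat_mono)
    also have "\<dots> = 2 * (\<Sum>j=\<Delta>..q. real (tent k i j)) + (real k - 1) * (real (tent k i \<Delta>) + real (tent k i q))
        + (3 * real k - 1) * real (\<Delta> - i)"
      using k_pos by (simp add: of_nat_diff)
    also have "\<dots> \<le> 2 * (\<Sum>j=\<Delta>..q. cutw j i) + (real k - 1) * (cutw \<Delta> i + cutw q i)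
        + (3 * real k - 1) * cutw 0 i"
      using q i k1 \<Delta>
      by (intro add_mono mult_left_mono sum_mono cutw_ge_tent cutw_0_ge) auto
    finally show ?thesis by simp
  qed
  have "(y 0 - y N) * (2 * real k^2) \<le> (\<Sum>i<N. (y i - y (Suc i)) *
      (2 * (\<Sum>j=\<Delta>..q. cutw j i) + (real k - 1) * (cutw \<Delta> i + cutw q i) + (3 * real k - 1) * cutw 0 i))"
    unfolding sum_steps[symmetric] sum_distrib_right
    by (intro sum_mono mult_left_mono cover) (use y_step in auto)
  also have "\<dots> = 2 * (\<Sum>j=\<Delta>..q. \<Sum>i<N. (y i - y (Suc i)) * cutw j i)
      + (real k - 1) * ((\<Sum>i<N. (y i - y (Suc i)) * cutw \<Delta> i) + (\<Sum>i<N. (y i - y (Suc i)) * cutw q i))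
      + (3 * real k - 1) * (\<Sum>i<N. (y i - y (Suc i)) * cutw 0 i)"
    by (rule sum_mult_combination)
  also have "\<dots> \<le> Z"
    unfolding Z_def using q k1
    by (intro add_mono mult_left_mono sum_mono flux_ge) auto
  also have "Z \<le> 2 * (\<Sum>j=\<Delta>..q. \<gamma> * y 0 * N) + (real k - 1) * (\<gamma> * y 0 * N + \<gamma> * y 0 * N)
      + (3 * real k - 1) * (\<gamma> * y 0)"
  proof -
    have "flux j \<le> \<gamma> * y 0 * N" if "j \<le> q" for j
    proof -
      have "\<gamma> * y 0 * (real j + 1) \<le> \<gamma> * y 0 * N"
        using that qN \<gamma>_nonneg y_pos by (intro mult_left_mono) auto
      then show ?thesis using flux_le[of j] that q by linarith
    qed
    then show ?thesis
      unfolding Z_def using q k1 flux_le[of 0] by (intro add_mono mult_left_mono sum_mono) auto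
  qed
  \<comment> \<open>There are \<open>N - \<Delta>\<close> cuts of multiplicity \<open>2\<close>, and
    the two outermost ones add \<open>2 * (k - 1)\<close>.\<close>
  also have "\<dots> = \<gamma> * y 0 * (2 * (real N - \<Delta> + k - 1) * N + (3 * real k - 1))"
    using q qN by (simp add: of_nat_diff algebra_simps)
  also have "\<dots> = 2 * (\<gamma> * y 0 * ((real N - \<Delta> + k - 1) * N + (3 * real k - 1) / 2))"
    by (simp add: field_simps)
  finally have "(y 0 - y N) * k^2 \<le> \<gamma> * y 0 * ((real N - \<Delta> + k - 1) * N + (3 * real k - 1) / 2)"
    by (simp only: mult.left_commute[of _ 2] mult_le_cancel_left_pos zero_less_numeral) simp
  \<comment> \<open>The available room is \<open>k * (\<Delta> - k + 1)\<close>, which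
    \<open>k < \<Delta>\<close> makes at least \<open>2 * k\<close>, more than
    \<open>(3 * k - 1) / 2\<close>.\<close>
  moreover have "(real N - \<Delta> + k - 1) * N + (3 * real k - 1) / 2 < resist"
  proof -
    have "resist - (real N - \<Delta> + k - 1) * N = real k * (real \<Delta> - k + 1)"
      by (simp add: resist_def algebra_simps)
    moreover have "real k * 2 \<le> real k * (real \<Delta> - k + 1)"
      using k_less by (intro mult_left_mono) auto
    moreover have "0 < real k" using k_pos by simp
    ultimately show ?thesis by argo
  qed
  ultimately show ?thesis
    by (intro exI[of _ "(real N - \<Delta> + k - 1) * N + (3 * real k - 1) / 2"] conjI)
qed

text \<open>In the total flux the coefficient of \<open>y N\<close> is the whole degree deficit, and
  the steps contribute nonnegative terms.\<close>

lemma y_min_le: "(\<Sum>a\<le>N. \<Delta> - (\<Sum>b\<le>N. w a b)) * y N \<le> \<gamma> * y 0 * (real N + 1)"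
proof -
  have "cutw N N = (\<Sum>a\<le>N. \<Delta> - (\<Sum>b\<le>N. w a b))"
    by (simp add: cutw_def sum_subtractf algebra_simps)
  moreover have "0 \<le> (\<Sum>i<N. (y i - y (Suc i)) * cutw N i)"
    by (intro sum_nonneg mult_nonneg_nonneg cutw_nonneg y_step) auto
  ultimately show ?thesis using flux_eq[of N] flux_le[of N] by simp
qed

text \<open>Weighting the drop bound by \<open>C\<close> and the bound on \<open>y N\<close> by
  \<open>k^2\<close> eliminates \<open>y N\<close>. Strictness comes from \<open>r < resist\<close>,
  once \<open>\<gamma>\<close> is known to be positive.\<close>

lemma gap_gt:
  fixes C :: real
  assumes C: "C = (\<Sum>a\<le>N. \<Delta> - (\<Sum>b\<le>N. w a b))"
  shows "C * k^2 / (C * resist + (real N + 1) * k^2) < \<gamma>"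
proof -
  have Cpos: "C > 0" using deficit_pos C by simp
  obtain r where r: "r < resist" "(y 0 - y N) * k^2 \<le> \<gamma> * y 0 * r" using drop_le by blast
  have "C * ((y 0 - y N) * k^2) \<le> C * (\<gamma> * y 0 * r)" using r Cpos by (intro mult_left_mono) auto
  moreover have "C * y N * k^2 \<le> \<gamma> * y 0 * (real N + 1) * k^2"
    using y_min_le C by (intro mult_right_mono) auto
  ultimately have "y 0 * (C * k^2) \<le> y 0 * (\<gamma> * (C * r + (real N + 1) * k^2))"
    by (simp add: algebra_simps)
  then have le: "C * k^2 \<le> \<gamma> * (C * r + (real N + 1) * k^2)" using y_pos by simp
  have "0 < C * k^2" using Cpos k_pos by simp
  then have "\<gamma> \<noteq> 0" using le by auto
  then have \<gamma>: "\<gamma> > 0" using \<gamma>_nonneg by simp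
  have "\<gamma> * (C * r + (real N + 1) * k^2) < \<gamma> * (C * resist + (real N + 1) * k^2)"
    using \<gamma> Cpos r by simp
  then have lt: "C * k^2 < \<gamma> * (C * resist + (real N + 1) * k^2)" using le by simp
  \<comment> \<open>The sign of the denominator is read off from \<open>lt\<close>, whose left side
    is positive.\<close>
  then have "0 < C * resist + (real N + 1) * k^2"
    using \<gamma> \<open>0 < C * k^2\<close> by (metis less_trans zero_less_mult_pos)
  then show ?thesis using lt by (simp add: pos_divide_less_eq)
qed

end

section \<open>Real eigenvalues of real symmetric matrices\<close>

text \<open>This makes the \<open>Max\<close> in \<open>lambda1\<close> an actual eigenvalue. A
  complex eigenvalue always exists, and symmetry forces it to be real.\<close>

lemma symmetric_real_spectrum_nonempty:
  fixes A :: "real mat"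
  assumes A: "A \<in> carrier_mat n n" and n: "n > 0"
    and sym: "\<And>i j. \<lbrakk>i < n; j < n\<rbrakk> \<Longrightarrow> A $$ (i, j) = A $$ (j, i)"
  shows "spectrum A \<noteq> {}"
proof -
  define B where "B = map_mat complex_of_real A"
  have B: "B \<in> carrier_mat n n" using A by (simp add: B_def)
  obtain c where "c \<in> spectrum B" using spectrum_non_empty[OF B n] by auto
  then have c: "eigenvalue B c" by (simp add: spectrum_def)
  then obtain v where v: "v \<in> carrier_vec n" "v \<noteq> 0\<^sub>v n" and ev: "B *\<^sub>v v = c \<cdot>\<^sub>v v"
    using B by (auto simp: eigenvalue_def eigenvector_def)
  have row: "(\<Sum>j<n. of_real (A $$ (i, j)) * v $ j) = c * v $ i" if "i < n" for i
  proof -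
    have "(B *\<^sub>v v) $ i = (\<Sum>j<n. of_real (A $$ (i, j)) * v $ j)"
      using that A v by (auto simp: B_def scalar_prod_def atLeast0LessThan intro!: sum.cong)
    then show ?thesis using that v by (simp add: ev)
  qed
  \<comment> \<open>The Hermitian form of \<open>v\<close>: it equals \<open>c\<close> times the
    squared norm \<open>s\<close>, and by symmetry of \<open>A\<close> it is its own
    conjugate.\<close>
  define q where "q = (\<Sum>i<n. \<Sum>j<n. of_real (A $$ (i, j)) * (cnj (v $ i) * v $ j))"
  define s where "s = (\<Sum>i<n. (cmod (v $ i))^2)"
  have "q = (\<Sum>i<n. cnj (v $ i) * (c * v $ i))"
    unfolding q_def by (rule sum.cong[OF refl]) (simp add: row[symmetric] sum_distrib_left mult_ac)
  also have "\<dots> = c * of_real s"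
    unfolding s_def of_real_sum sum_distrib_left
    by (rule sum.cong[OF refl]) (simp add: complex_norm_square[symmetric] mult_ac flip: of_real_power)
  finally have q: "q = c * of_real s" .
  have "cnj q = (\<Sum>i<n. \<Sum>j<n. of_real (A $$ (j, i)) * (cnj (v $ j) * v $ i))"
    unfolding q_def by (auto simp: sym mult_ac intro!: sum.cong)
  also have "\<dots> = q" unfolding q_def by (rule sum.swap)
  finally have "cnj c * of_real s = c * of_real s" by (simp add: q)
  moreover have "s \<noteq> 0"
  proof
    assume "s = 0"
    then have "\<forall>i<n. v $ i = 0" by (simp add: s_def sum_nonneg_eq_0_iff)
    then show False using v by (auto intro!: eq_vecI)
  qed
  ultimately have "cnj c = c" by simp
  then obtain r where r: "c = of_real r" by (metis Reals_cases Reals_cnj_iff)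
  \<comment> \<open>The characteristic polynomial of \<open>B\<close> is the image of that of
    \<open>A\<close>, so a real root gives an eigenvalue of \<open>A\<close> itself.\<close>
  have "poly (char_poly B) c = 0" using c eigenvalue_root_char_poly[OF B] by simp
  then have "complex_of_real (poly (char_poly A) r) = 0"
    by (simp add: B_def r of_real_hom.char_poly_hom[OF A])
  then have "eigenvalue A r" using eigenvalue_root_char_poly[OF A] by simp
  then show ?thesis by (auto simp: spectrum_def)
qed

section \<open>Degrees, edge cuts and an eigenvector in a simple graph\<close>

context graph
begin

lemma adj_sym: "u \<rightarrow>\<^bsub>G\<^esub> v \<longleftrightarrow> v \<rightarrow>\<^bsub>G\<^esub> u"
  using arcs_ends_symmetric[OF sym_arcs] by blast

lemma out_degree_eq_card: "out_degree G v = card {u \<in> verts G. v \<rightarrow>\<^bsub>G\<^esub> u}"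
proof -
  have "bij_betw (head G) (out_arcs G v) {u \<in> verts G. v \<rightarrow>\<^bsub>G\<^esub> u}"
  proof (rule bij_betwI')
    fix e f assume "e \<in> out_arcs G v" "f \<in> out_arcs G v"
    then show "head G e = head G f \<longleftrightarrow> e = f"
      using no_multi_arcs[of e f] by (auto simp: arc_to_ends_def)
  qed (auto simp: arcs_ends_conv)
  then show ?thesis unfolding out_degree_def by (rule bij_betw_same_card)
qed

lemma sum_out_degree: "(\<Sum>v\<in>verts G. out_degree G v) = card (arcs G)"
proof -
  have "(\<Sum>v\<in>verts G. \<Sum>e\<in>{e \<in> arcs G. tail G e = v}. 1) = (\<Sum>e\<in>arcs G. 1 :: nat)"
    by (rule sum.group) auto
  then show ?thesis by (simp add: out_degree_def out_arcs_def)
qed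

text \<open>Each end pair comes from exactly two opposite arcs, which differ since there are no
  loops.\<close>

lemma card_arcs: "card (arcs G) = 2 * graph_size G"
proof -
  let ?ends = "\<lambda>e. {tail G e, head G e}"
  have "card {e \<in> arcs G. ?ends e = p} = 2" if p: "p \<in> ?ends ` arcs G" for p
  proof -
    obtain e where e: "e \<in> arcs G" "p = ?ends e" using p by auto
    obtain f where f: "f \<in> arcs G" "tail G f = head G e" "head G f = tail G e"
      using sym_arcs e unfolding symmetric_conv by metis
    have "e \<noteq> f" using no_loops[OF e(1)] f by auto
    moreover have "{e \<in> arcs G. ?ends e = p} = {e, f}"
      using e f by (auto simp: doubleton_eq_iff arc_to_ends_def intro: no_multi_arcs)
    ultimately show ?thesis by simp
  qed
  then show ?thesis
    using sum.image_gen[of "arcs G" "\<lambda>_. 1 :: nat" ?ends] by (simp add: graph_size_def)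
qed

text \<open>If some \<open>s \<in> A\<close> and \<open>t \<in> B\<close> are not adjacent, then the vertices outside \<open>A \<union> B\<close> together with
  one end in \<open>- {s, t}\<close> of every edge between \<open>A\<close> and \<open>B\<close> separate \<open>s\<close> from \<open>t\<close>.\<close>

lemma k_connected_cut:
  assumes conn: "k_connected k G"
    and A: "A \<subseteq> verts G" "A \<noteq> {}" and B: "B \<subseteq> verts G" "B \<noteq> {}" and AB: "A \<inter> B = {}"
  shows "k + card A + card B \<le> card {(a, b) \<in> A \<times> B. a \<rightarrow>\<^bsub>G\<^esub> b} + card (verts G)"
proof -
  define X where "X = {(a, b) \<in> A \<times> B. a \<rightarrow>\<^bsub>G\<^esub> b}"
  have fin: "finite A" "finite B" using A B finite_subset[OF _ finite_verts] by auto
  then have finX: "finite X" unfolding X_def by (rule_tac finite_subset[of _ "A \<times> B"]) auto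
  show ?thesis
  proof (cases "\<forall>a\<in>A. \<forall>b\<in>B. a \<rightarrow>\<^bsub>G\<^esub> b")
    case True
    then have "X = A \<times> B" by (auto simp: X_def)
    then have "card X = card A * card B" by (simp add: card_cartesian_product)
    \<comment> \<open>This is \<open>(card A - 1) * (card B - 1) \<ge> 0\<close>; together with
      \<open>k < card (verts G)\<close> it settles the complete case.\<close>
    moreover have "card A + card B \<le> card A * card B + 1"
    proof -
      obtain x where "card A = Suc x" using A fin by (metis card_gt_0_iff gr0_implies_Suc)
      moreover obtain z where "card B = Suc z" using B fin by (metis card_gt_0_iff gr0_implies_Suc)
      ultimately show ?thesis by simp
    qed
    moreover have "k < card (verts G)" using conn by (simp add: k_connected_def)
    ultimately show ?thesis by (simp add: X_def)
  next
    case False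
    then obtain s t where st: "s \<in> A" "t \<in> B" "\<not> s \<rightarrow>\<^bsub>G\<^esub> t" by auto
    \<comment> \<open>The chosen end is neither \<open>s\<close> nor \<open>t\<close>: if
      \<open>a = s\<close>, then \<open>b\<close> is a neighbour of \<open>s\<close>, which
      \<open>t\<close> is not.\<close>
    define S where "S = (verts G - A - B) \<union> (\<lambda>(a, b). if a \<noteq> s then a else b) ` X"
    have "S \<subseteq> verts G" using A B by (auto simp: S_def X_def)
    moreover have "\<not> Digraph_Component.connected (G \<restriction> (verts G - S))"
    proof
      let ?H = "mk_symmetric (G \<restriction> (verts G - S))"
      assume "Digraph_Component.connected (G \<restriction> (verts G - S))"
      moreover have "s \<notin> S" "t \<notin> S" using st AB by (auto simp: S_def X_def split: if_splits)
      ultimately have "s \<rightarrow>\<^sup>*\<^bsub>?H\<^esub> t"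
        using st A B unfolding Digraph_Component.connected_def strongly_connected_def by auto
      then have "(s, t) \<in> (arcs_ends ?H)\<^sup>*" by (rule reachable_rtranclI)
      \<comment> \<open>A walk from \<open>s\<close> avoiding \<open>S\<close> never leaves
        \<open>A\<close>: vertices outside \<open>A \<union> B\<close> are deleted, and every edge
        from \<open>A\<close> to \<open>B\<close> has lost an end.\<close>
      then have "t \<in> A"
      proof (induction rule: rtrancl_induct)
        case (step x z)
        then have "(x, z) \<in> parcs ?H" by simp
        then have "x \<rightarrow>\<^bsub>G\<^esub> z \<or> z \<rightarrow>\<^bsub>G\<^esub> x" and "x \<in> verts G - S" "z \<in> verts G - S"
          by (auto simp: parcs_mk_symmetric in_arcs_imp_in_arcs_ends)
        then have xz: "x \<rightarrow>\<^bsub>G\<^esub> z" "x \<in> verts G - S" "z \<in> verts G - S"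
          using adj_sym by blast+
        have "z \<notin> B"
        proof
          assume "z \<in> B"
          then have "(x, z) \<in> X" using step xz by (simp add: X_def)
          then have "(if x \<noteq> s then x else z) \<in> S" unfolding S_def by force
          then show False using xz by (auto split: if_splits)
        qed
        then show ?case using xz by (auto simp: S_def)
      qed (rule st)
      then show False using st AB by auto
    qed
    ultimately have "k \<le> card S" using conn by (auto simp: k_connected_def not_less[symmetric])
    also have "card S \<le> card (verts G - A - B) + card X"
      unfolding S_def by (rule order_trans[OF card_Un_le]) (simp add: card_image_le finX)
    also have "verts G - A - B = verts G - (A \<union> B)" by blast
    also have "card \<dots> = card (verts G) - card (A \<union> B)"
      using A B fin by (intro card_Diff_subset) auto
    finally show ?thesis
      using card_mono[OF finite_verts, of "A \<union> B"] A B AB fin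
      by (simp add: X_def card_Un_disjoint)
  qed
qed

text \<open>The eigenvector becomes a function on the vertices, free of any listing, so that they
  can be sorted by it afterwards.\<close>

lemma lambda1_eigenvector:
  assumes "verts G \<noteq> {}"
  obtains f where "\<And>v. v \<in> verts G \<Longrightarrow> (\<Sum>u\<in>verts G. of_bool (v \<rightarrow>\<^bsub>G\<^esub> u) * f u) = lambda1 G * f v"
    and "\<exists>v\<in>verts G. f v \<noteq> 0"
proof -
  obtain vs where vs: "distinct vs" "set vs = verts G"
    using finite_distinct_list[OF finite_verts] by blast
  let ?n = "length vs" and ?A = "adjacency_matrix G vs"
  have A: "?A \<in> carrier_mat ?n ?n" by (simp add: adjacency_matrix_def)
  have "?n > 0" using vs assms by auto
  moreover have "?A $$ (i, j) = ?A $$ (j, i)" if "i < ?n" "j < ?n" for i j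
    using that adj_sym[of "vs ! i" "vs ! j"] by (simp add: adjacency_matrix_def)
  ultimately have "spectrum ?A \<noteq> {}" by (rule symmetric_real_spectrum_nonempty[OF A])
  then have "lambda1 G \<in> spectrum ?A"
    unfolding lambda1_eq[OF vs] by (rule Max_in[OF card_finite_spectrum(1)[OF A]])
  then obtain x where x: "x \<in> carrier_vec ?n" "x \<noteq> 0\<^sub>v ?n" and ev: "?A *\<^sub>v x = lambda1 G \<cdot>\<^sub>v x"
    using A by (auto simp: spectrum_def eigenvalue_def eigenvector_def)
  have bij: "bij_betw ((!) vs) {..<?n} (verts G)" using vs by (simp add: bij_betw_nth)
  define f where "f v = x $ the_inv_into {..<?n} ((!) vs) v" for v
  have f: "f (vs ! i) = x $ i" if "i < ?n" for i
    using that bij by (simp add: f_def the_inv_into_f_f bij_betw_def)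
  show thesis
  proof
    fix v assume "v \<in> verts G"
    then obtain i where i: "i < ?n" "v = vs ! i" using bij by (auto simp: bij_betw_def)
    have "(\<Sum>u\<in>verts G. of_bool (v \<rightarrow>\<^bsub>G\<^esub> u) * f u) = (\<Sum>j<?n. of_bool (v \<rightarrow>\<^bsub>G\<^esub> vs ! j) * f (vs ! j))"
      by (rule sum.reindex_bij_betw[OF bij, symmetric])
    also have "\<dots> = (?A *\<^sub>v x) $ i"
      by (subst adjacency_matrix_mult_vec[OF x(1) i(1)]) (auto simp: i f of_bool_def intro!: sum.cong)
    also have "\<dots> = lambda1 G * f v" using i x by (simp add: ev f)
    finally show "(\<Sum>u\<in>verts G. of_bool (v \<rightarrow>\<^bsub>G\<^esub> u) * f u) = lambda1 G * f v" .
  next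
    obtain i where "i < ?n" "x $ i \<noteq> 0" using x by (metis carrier_vecD eq_vecI index_zero_vec)
    then show "\<exists>v\<in>verts G. f v \<noteq> 0" using f vs by (metis nth_mem)
  qed
qed

end

section \<open>Transfer of the weighted estimate to the graph\<close>

theorem theorem1p6:
  fixes G :: "('a, 'b) pre_digraph" and k n m \<Delta> :: nat
  assumes "graph G"
    and "k > 0"
    and "k_connected k G"
    and "irregular G"
    and "graph_order G = n"
    and "graph_size G = m"
    and "max_degree G = \<Delta>"
  shows "real \<Delta> - lambda1 G >
    (real n * real \<Delta> - 2 * real m) * (real k)^2 /
    ((real n * real \<Delta> - 2 * real m) *
       ((real n - 1)^2 - (real n - real k - 1) * (real \<Delta> - real k + 1))
     + real n * (real k)^2)"
proof -
  interpret graph G by fact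
  have n: "card (verts G) = n" using assms(5) by (simp add: graph_order_def)
  have kn: "k < n" using assms(3) n by (simp add: k_connected_def)
  define N where "N = n - 1"
  have nN: "n = Suc N" using kn by (simp add: N_def)
  have ne: "verts G \<noteq> {}" using n nN by auto
  have deg_le: "out_degree G v \<le> \<Delta>" if "v \<in> verts G" for v
    using assms(7) that by (auto simp: max_degree_def)
  \<comment> \<open>The cut between \<open>v\<close> and all other vertices consists of the edges at
    \<open>v\<close>.\<close>
  have deg_ge: "k \<le> out_degree G v" if v: "v \<in> verts G" for v
  proof -
    have "card (verts G - {v}) = N" using v n nN by simp
    moreover from this have "0 < card (verts G - {v})" using kn nN assms(2) by linarith
    then have "verts G - {v} \<noteq> {}" by force
    ultimately have "k \<le> card {(a, b) \<in> {v} \<times> (verts G - {v}). a \<rightarrow>\<^bsub>G\<^esub> b}"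
      using k_connected_cut[OF assms(3), of "{v}" "verts G - {v}"] v n nN by simp
    also have "{(a, b) \<in> {v} \<times> (verts G - {v}). a \<rightarrow>\<^bsub>G\<^esub> b} = Pair v ` {u \<in> verts G. v \<rightarrow>\<^bsub>G\<^esub> u}"
      by (auto dest: adj_not_same)
    also have "card \<dots> = out_degree G v"
      by (simp add: card_image inj_on_def out_degree_eq_card)
    finally show ?thesis .
  qed
  obtain v0 where v0: "v0 \<in> verts G" "out_degree G v0 < \<Delta>"
    using assms(4) deg_le unfolding irregular_def by (metis le_neq_implies_less)
  have k\<Delta>: "k < \<Delta>" using deg_ge[OF v0(1)] v0(2) by simp
  have \<Delta>N: "\<Delta> \<le> N"
  proof -
    have "\<Delta> \<in> out_degree G ` verts G"
      using assms(7) ne by (auto simp: max_degree_def intro!: Max_in)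
    then obtain v where v: "v \<in> verts G" "\<Delta> = out_degree G v" by auto
    have "out_degree G v \<le> card (verts G - {v})"
      unfolding out_degree_eq_card by (rule card_mono) (auto dest: adj_not_same)
    then show ?thesis using v n nN by simp
  qed

  obtain f where f: "\<And>v. v \<in> verts G \<Longrightarrow> (\<Sum>u\<in>verts G. of_bool (v \<rightarrow>\<^bsub>G\<^esub> u) * f u) = lambda1 G * f v"
    and f0: "\<exists>v\<in>verts G. f v \<noteq> 0"
    using lambda1_eigenvector[OF ne] by blast
  obtain us where us: "distinct us" "set us = verts G"
    using finite_distinct_list[OF finite_verts] by blast
  define vs where "vs = sort_key (\<lambda>v. - \<bar>f v\<bar>) us"
  have vs: "distinct vs" "set vs = verts G" using us by (simp_all add: vs_def)
  have len: "length vs = Suc N" using vs n nN distinct_card by fastforce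
  have sorted: "sorted (map (\<lambda>v. - \<bar>f v\<bar>) vs)" unfolding vs_def by (rule sorted_sort_key)
  have bij: "bij_betw ((!) vs) {..N} (verts G)"
    using bij_betw_nth[of vs "{..N}" "verts G"] vs len by (simp add: lessThan_Suc_atMost)
  have mem: "vs ! i \<in> verts G" if "i \<le> N" for i
    using bij that by (auto simp: bij_betw_def)
  have inj: "inj_on ((!) vs) I" if "I \<subseteq> {..N}" for I
    using bij that by (auto simp: bij_betw_def intro: inj_on_subset)
  define w :: "nat \<Rightarrow> nat \<Rightarrow> real" where "w i j = of_bool (i \<le> N \<and> j \<le> N \<and> vs ! i \<rightarrow>\<^bsub>G\<^esub> vs ! j)" for i j
  define y where "y i = \<bar>f (vs ! i)\<bar>" for i
  have sum_w: "(\<Sum>b\<le>N. w a b * g (vs ! b)) = (\<Sum>u\<in>verts G. of_bool (vs ! a \<rightarrow>\<^bsub>G\<^esub> u) * g u)"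
    if "a \<le> N" for a g
    unfolding sum.reindex_bij_betw[OF bij, symmetric] using that by (auto simp: w_def)
  have deg: "(\<Sum>b\<le>N. w a b) = out_degree G (vs ! a)" if "a \<le> N" for a
    using sum_w[OF that, of "\<lambda>_. 1"] by (simp add: out_degree_eq_card sum_of_bool_eq Int_def)
  have C: "(\<Sum>a\<le>N. \<Delta> - (\<Sum>b\<le>N. w a b)) = real n * \<Delta> - 2 * m"
  proof -
    have "(\<Sum>a\<le>N. \<Delta> - (\<Sum>b\<le>N. w a b)) = (\<Sum>v\<in>verts G. real \<Delta> - out_degree G v)"
      unfolding sum.reindex_bij_betw[OF bij, symmetric] by (rule sum.cong) (auto simp: deg)
    also have "\<dots> = real n * \<Delta> - 2 * m"
      using n assms(6) card_arcs sum_out_degree by (simp add: sum_subtractf flip: of_nat_sum)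
    finally show ?thesis .
  qed
  interpret ordered_weights N k \<Delta> w y "real \<Delta> - lambda1 G"
  proof
    show "w a b = w b a" for a b using adj_sym[of "vs ! a" "vs ! b"] by (auto simp: w_def)
    show "w a a = 0" for a using adj_not_same by (auto simp: w_def)
    show "(\<Sum>b\<le>N. w a b) \<le> \<Delta>" if "a \<le> N" for a using deg[OF that] deg_le mem that by simp
    show anti: "y j \<le> y i" if "i \<le> j" "j \<le> N" for i j
      using sorted_nth_mono[OF sorted, of i j] that len by (simp add: y_def)
    obtain i where "i \<le> N" "f (vs ! i) \<noteq> 0" using f0 bij_betw_imp_surj_on[OF bij, symmetric] by auto
    then show "0 < y 0" using anti[of 0 i] by (simp add: y_def)
    show "\<Delta> * y a - (\<Sum>b\<le>N. w a b * y b) \<le> (real \<Delta> - lambda1 G) * y a" if a: "a \<le> N" for a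
    proof -
      \<comment> \<open>The triangle inequality turns the eigenvalue equation into
        \<open>super\<close>.\<close>
      have "lambda1 G * y a \<le> \<bar>lambda1 G * f (vs ! a)\<bar>"
        by (simp add: y_def abs_mult mult_right_mono)
      also have "\<dots> = \<bar>\<Sum>b\<le>N. w a b * f (vs ! b)\<bar>" using f[OF mem[OF a]] sum_w[OF a, of f] by simp
      also have "\<dots> \<le> (\<Sum>b\<le>N. w a b * y b)"
        by (rule order_trans[OF sum_abs]) (auto simp: y_def abs_mult w_def intro!: sum_mono)
      finally show ?thesis by (simp add: left_diff_distrib)
    qed
    show "k \<le> (\<Sum>a\<le>j. \<Sum>b\<in>{i<..N}. w a b) + (real i - real j)" if ij: "j \<le> i" "i < N" for i j
    proof -
      let ?A = "(!) vs ` {..j}" and ?B = "(!) vs ` {i<..N}"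
      have inj': "inj_on ((!) vs) {..j}" "inj_on ((!) vs) {i<..N}" using ij by (auto intro!: inj)
      have fin: "finite ?A" "finite ?B" by auto
      have "?A \<inter> ?B = {}"
        using inj[of "{..N}"] ij by (force simp: inj_on_def)
      then have "k + card ?A + card ?B \<le> card {(a, b) \<in> ?A \<times> ?B. a \<rightarrow>\<^bsub>G\<^esub> b} + card (verts G)"
        using ij mem by (intro k_connected_cut[OF assms(3)]) auto
      \<comment> \<open>Together the two sides have \<open>N + 1 - (i - j)\<close> vertices, which
        produces the term \<open>i - j\<close>.\<close>
      moreover have "card ?A = j + 1" "card ?B = N - i" using inj' by (simp_all add: card_image)
      moreover have "real (card {(a, b) \<in> ?A \<times> ?B. a \<rightarrow>\<^bsub>G\<^esub> b}) = (\<Sum>a\<le>j. \<Sum>b\<in>{i<..N}. w a b)"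
      proof -
        have "{(a, b) \<in> ?A \<times> ?B. a \<rightarrow>\<^bsub>G\<^esub> b} = Sigma ?A (\<lambda>a. {b \<in> ?B. a \<rightarrow>\<^bsub>G\<^esub> b})" by auto
        then have "real (card {(a, b) \<in> ?A \<times> ?B. a \<rightarrow>\<^bsub>G\<^esub> b}) = (\<Sum>a\<in>?A. \<Sum>b\<in>?B. of_bool (a \<rightarrow>\<^bsub>G\<^esub> b))"
          using fin by (simp add: card_SigmaI sum_of_bool_eq Int_def)
        also have "\<dots> = (\<Sum>a\<le>j. \<Sum>b\<in>{i<..N}. of_bool (vs ! a \<rightarrow>\<^bsub>G\<^esub> vs ! b))"
          by (simp only: sum.reindex[OF inj'(1)] sum.reindex[OF inj'(2)] o_def)
        also have "\<dots> = (\<Sum>a\<le>j. \<Sum>b\<in>{i<..N}. w a b)"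
          using ij by (auto simp: w_def intro!: sum.cong)
        finally show ?thesis .
      qed
      ultimately show ?thesis using n nN ij by linarith
    qed
    show "0 < (\<Sum>a\<le>N. \<Delta> - (\<Sum>b\<le>N. w a b))"
    proof -
      \<comment> \<open>The vertex \<open>v0\<close> of degree below \<open>\<Delta>\<close>
        contributes a positive term.\<close>
      obtain i where i: "i \<le> N" "v0 = vs ! i" using v0 bij by (auto simp: bij_betw_def)
      show ?thesis
        by (rule sum_pos2[of _ i]) (use i v0 deg deg_le mem in auto)
    qed
  qed (use assms(2) k\<Delta> \<Delta>N in \<open>auto simp: w_def y_def\<close>)
  have "resist = (real n - 1)^2 - (real n - real k - 1) * (real \<Delta> - real k + 1)"
    by (simp add: resist_def nN power2_eq_square algebra_simps)
  then show ?thesis using gap_gt[OF C[symmetric]] nN by (simp add: add.commute)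
qed

end
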